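(* Let $X$ be a real linear space, $C\subseteq X$ a convex subset, $f:C\to\mathbb{R}$ a non-negative function, and $h:J\to\mathbb{R}$ a non-negative function. For $t\in[0,1]$ define $f_t:C^2\to\mathbb{R}$ by $f_t(x,y)=f(tx+(1-t)y)$, where $C^2=C\times C\subseteq X\times X$. Then: (i) If $f$ is an $h$-convex function on $C$, then $f_t$ is an $h$-convex function on $C^2$ for every $t\in[0,1]$. (ii) If $C$ is a cone in $X$ and $f_t$ is an $h$-convex function on $C^2$ for every $t\in(0,1)$, then $f$ is an $h$-convex function on $C$.
   Context: $J\subseteq\mathbb{R}$ is an interval containing $[0,1]$, and $h:J\to\mathbb{R}$ is non-negative and not identically zero. A non-negative function $g:D\to\mathbb{R}$ on a convex subset $D$ of a real linear space is called $h$-convex on $D$ if $g(tx+(1-t)y)\le h(t)g(x)+h(1-t)g(y)$ for all $x,y\in D$ and all $t\in[0,1]$. A set $C\subseteq X$ is a cone if $C+C\subseteq C$ and $\alpha C\subseteq C$ for every $\alpha\ge 0$. *)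

theory Defs
  imports "HOL-Analysis.Analysis"
begin

(* The standing requirements of the notion (convex domain, non-negative function) are part of
   the predicate.  Only the values of h on [0,1] occur; the conditions on h and on its domain J
   are hypotheses of the theorem. *)
definition h_convex_on :: "(real \<Rightarrow> real) \<Rightarrow> 'a::real_vector set \<Rightarrow> ('a \<Rightarrow> real) \<Rightarrow> bool" where
  "h_convex_on h D g \<longleftrightarrow>
     convex D \<and> (\<forall>x\<in>D. 0 \<le> g x) \<and>
     (\<forall>x\<in>D. \<forall>y\<in>D. \<forall>t\<in>{0..1}.
        g (t *\<^sub>R x + (1 - t) *\<^sub>R y) \<le> h t * g x + h (1 - t) * g y)"

(* The library predicate cone only demands closure under non-negative scaling. *)
definition additive_cone :: "'a::real_vector set \<Rightarrow> bool" where
  "additive_cone C \<longleftrightarrow> (\<forall>x\<in>C. \<forall>y\<in>C. x + y \<in> C) \<and> cone C"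

definition mix :: "('a::real_vector \<Rightarrow> real) \<Rightarrow> real \<Rightarrow> 'a \<times> 'a \<Rightarrow> real" where
  "mix f t = (\<lambda>(x, y). f (t *\<^sub>R x + (1 - t) *\<^sub>R y))"

end

theory Submission
  imports Defs
begin

text \<open>
  The map (x, y) \<mapsto> tx + (1 - t)y is linear, so \<open>h\<close>-convexity of \<open>f\<close> passes to its composition
  with this map. Conversely, the map sends the diagonal point (x, x) to x, so \<open>h\<close>-convexity
  of a single \<open>f\<^sub>t\<close> restricted to the diagonal is \<open>h\<close>-convexity of \<open>f\<close>.
\<close>

text \<open>The weights \<open>t\<close> and \<open>1 - t\<close> add up to 1 for every real
  \<open>t\<close>.\<close>

lemma mix_diagonal [simp]: "mix f t (x, x) = f x"
  by (simp add: mix_def flip: scaleR_add_left)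

lemma h_convex_on_mix:
  fixes C :: "'a::real_vector set"
  assumes "h_convex_on h C f" and t: "t \<in> {0..1}"
  shows "h_convex_on h (C \<times> C) (mix f t)"
proof -
  have C: "convex C" and nonneg: "\<And>x. x \<in> C \<Longrightarrow> 0 \<le> f x"
    and hconv: "\<And>x y s. x \<in> C \<Longrightarrow> y \<in> C \<Longrightarrow> s \<in> {0..1} \<Longrightarrow>
      f (s *\<^sub>R x + (1 - s) *\<^sub>R y) \<le> h s * f x + h (1 - s) * f y"
    using assms by (auto simp: h_convex_on_def)
  have comb: "t *\<^sub>R x + (1 - t) *\<^sub>R y \<in> C" if "x \<in> C" "y \<in> C" for x y
    using C that t by (simp add: convexD)
  have "mix f t (s *\<^sub>R (x, y) + (1 - s) *\<^sub>R (u, v)) \<le> h s * mix f t (x, y) + h (1 - s) * mix f t (u, v)"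
    if "x \<in> C" "y \<in> C" "u \<in> C" "v \<in> C" "s \<in> {0..1}" for x y u v s
  proof -
    \<comment> \<open>Interchange of the two combinations: scalars commute, so both sides expand to
      the same four terms. With \<open>s\<close> outermost, \<open>hconv\<close> applies to the two
      \<open>t\<close>-combinations, which lie in \<open>C\<close> by \<open>comb\<close>.\<close>
    have "t *\<^sub>R (s *\<^sub>R x + (1 - s) *\<^sub>R u) + (1 - t) *\<^sub>R (s *\<^sub>R y + (1 - s) *\<^sub>R v) =
        s *\<^sub>R (t *\<^sub>R x + (1 - t) *\<^sub>R y) + (1 - s) *\<^sub>R (t *\<^sub>R u + (1 - t) *\<^sub>R v)"
      by (simp add: scaleR_add_right mult.commute add_ac)
    with hconv[OF comb comb] that show ?thesis
      by (simp add: mix_def)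
  qed
  then show ?thesis
    using C comb nonneg unfolding h_convex_on_def by (auto simp: convex_Times mix_def)
qed

lemma h_convex_on_if_mix:
  fixes C :: "'a::real_vector set"
  assumes "convex C" and mix: "h_convex_on h (C \<times> C) (mix f t)"
  shows "h_convex_on h C f"
proof -
  \<comment> \<open>Non-negativity of \<open>mix f t\<close> is part of its
    \<open>h\<close>-convexity; it is read off at \<open>(x, x)\<close>.\<close>
  have "0 \<le> f x" if "x \<in> C" for x
    using mix that mix_diagonal[of f t x] unfolding h_convex_on_def by (metis SigmaI)
  moreover have "f (s *\<^sub>R x + (1 - s) *\<^sub>R y) \<le> h s * f x + h (1 - s) * f y"
    if "x \<in> C" "y \<in> C" "s \<in> {0..1}" for x y s
  proof -
    \<comment> \<open>A combination of diagonal points is again diagonal, so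
      \<open>mix_diagonal\<close> turns all three values of \<open>mix f t\<close> into values of
      \<open>f\<close>.\<close>
    have "mix f t (s *\<^sub>R (x, x) + (1 - s) *\<^sub>R (y, y)) \<le> h s * mix f t (x, x) + h (1 - s) * mix f t (y, y)"
      using mix that unfolding h_convex_on_def by blast
    then show ?thesis by simp
  qed
  ultimately show ?thesis
    using \<open>convex C\<close> by (auto simp: h_convex_on_def)
qed

theorem theorem3p2:
  fixes J :: "real set"
    and h :: "real \<Rightarrow> real"
    and C :: "'a::real_vector set"
    and f :: "'a \<Rightarrow> real"
  assumes J_interval: "is_interval J"
    and J_unit: "{0..1} \<subseteq> J"
    and h_nonneg: "\<And>s. s \<in> J \<Longrightarrow> 0 \<le> h s"
    and h_nonzero: "\<exists>s\<in>J. h s \<noteq> 0"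
    and C_convex: "convex C"
    and f_nonneg: "\<And>x. x \<in> C \<Longrightarrow> 0 \<le> f x"
  shows "(h_convex_on h C f \<longrightarrow> (\<forall>t\<in>{0..1}. h_convex_on h (C \<times> C) (mix f t))) \<and>
         (additive_cone C \<and> (\<forall>t\<in>{0<..<1}. h_convex_on h (C \<times> C) (mix f t)) \<longrightarrow>
            h_convex_on h C f)"
proof -
  \<comment> \<open>A witness that the open interval is inhabited: the converse uses the hypothesis
    at one \<open>t\<close> only, and the midpoint serves.\<close>
  have "(1/2 :: real) \<in> {0<..<1}" by simp
  then show ?thesis
    using h_convex_on_mix h_convex_on_if_mix[OF C_convex] by blast
qed

end
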